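(* Suppose there exists $x' \in \mathbb{R}^{n_0}$ such that $g_i^*(x') > -\infty$ for each $i \in I$. If $(x^*,y^* )$ is a minimum disequilibrium solution, i.e. a solution of the problem $$ (\mathrm{MD})\qquad \delta = \inf_{x,y_1,\dots,y_m} \; \sum_{i\in I} g_i^a(y_i) - \sum_{i\in I} g_i^*(x) \quad\text{s.t.}\quad \sum_{i\in I} g_{i,k}^b(y_i) = 0\ \ \forall k\in K,\quad x\in\mathbb{R}^{n_0},\quad y_i\in Y_i\ \ \forall i\in I, $$ then $\delta$ equals the duality gap $\delta^P - \delta^D$, where $$ (\mathrm{P})\qquad \delta^P = \inf_{y_1,\dots,y_m}\; \sum_{i\in I} g_i^a(y_i) \quad\text{s.t.}\quad \sum_{i\in I} g_{i,k}^b(y_i) = 0\ \ \forall k\in K,\quad y_i\in Y_i\ \ \forall i\in I, $$ and $$ (\mathrm{D})\qquad \delta^D = \sup_{x\in\mathbb{R}^{n_0}} \; \inf_{z_1,\dots,z_m}\Bigl\{ \sum_{i\in I} g_i^a(z_i) + \sum_{k\in K} x_k \sum_{i\in I} g_{i,k}^b(z_i) \;:\; z_i\in Y_i\ \forall i\in I \Bigr\}. $$ Further, $(x^*,y^* )$ is a solution of (MD) if and only if $y^* = (y_1^*,\dots,y_m^* )$ is optimal for (P) and $x^*$ is optimal for (D).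
   Context: Let $I=\{1,\dots,m\}$ and $K = \{1,\dots,n_0\}$. For each $i\in I$ let $Y_i\subset\mathbb{R}^{n_i}$ be nonempty, and let $g_i^a : Y_i\to\mathbb{R}$ and $g_{i,k}^b : Y_i\to\mathbb{R}$ ($k\in K$) be arbitrary real-valued functions (no convexity or continuity is assumed). For $x = (x_1,\dots,x_{n_0}) \in\mathbb{R}^{n_0}$, player $i$'s objective is $g_i(x,z_i) = g_i^a(z_i) + \sum_{k\in K} x_k g_{i,k}^b(z_i)$ and player $i$'s optimal value is $$ g_i^*(x) = \inf_{z_i}\Bigl\{ g_i^a(z_i) + \sum_{k\in K} x_k\, g_{i,k}^b(z_i) : z_i\in Y_i\Bigr\} \in [-\infty,+\infty). $$ The global constraint set is $G = \mathbb{R}^{n_0}\times\{(y_1,\dots,y_m) : \sum_{i\in I} g_{i,k}^b(y_i)=0\ \forall k\in K\}$. A minimum disequilibrium solution is a minimizer of $\sum_{i\in I}(g_i(x,y_i) - g_i^*(x))$ over $(x,y)\in G$ with $y_i\in Y_i$ for all $i$; on this feasible set $\sum_{i} g_i(x,y_i) = \sum_i g_i^a(y_i)$, which gives the form (MD) used in the claim. Problem (D) is the Lagrangian dual of (P), and its inner infimum equals $\sum_{i\in I} g_i^*(x)$. A "solution" of, or "optimal" point for, an optimization problem is a feasible point whose (extended-real) objective value equals the optimal value; in particular $x^*$ is optimal for (D) if $\sum_{i\in I} g_i^*(x^* ) = \delta^D$. Infima over empty sets are $+\infty$. *)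

theory Defs
  imports Complex_Main "HOL-Library.Extended_Real" "HOL-Library.FuncSet"
begin

text \<open>
  The dimensions \<open>n\<^sub>i\<close> differ from player to player, so a point of \<open>\<real>\<^sup>d\<close> is encoded as a function
  on \<open>nat\<close> with indices \<open>1, \<dots>, d\<close>, extensional (constantly \<open>undefined\<close>) outside of them, which makes
  the encoding one-to-one.  Likewise a profile \<open>y = (y\<^sub>1, \<dots>, y\<^sub>m)\<close> with \<open>y\<^sub>i \<in> Y\<^sub>i\<close> is an element of
  \<open>PiE {1..m} Y\<close>.  Only the values of \<open>ga i\<close> and \<open>gb i k\<close> on \<open>Y i\<close> matter.
\<close>

type_synonym rvec = "nat \<Rightarrow> real"

definition real_space :: "nat \<Rightarrow> rvec set" where
  "real_space d = {1..d} \<rightarrow>\<^sub>E UNIV"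

definition player_obj ::
  "nat \<Rightarrow> (nat \<Rightarrow> rvec \<Rightarrow> real) \<Rightarrow> (nat \<Rightarrow> nat \<Rightarrow> rvec \<Rightarrow> real) \<Rightarrow> nat \<Rightarrow> rvec \<Rightarrow> rvec \<Rightarrow> real" where
  "player_obj n0 ga gb i x z = ga i z + (\<Sum>k\<in>{1..n0}. x k * gb i k z)"

definition player_opt ::
  "nat \<Rightarrow> (nat \<Rightarrow> rvec set) \<Rightarrow> (nat \<Rightarrow> rvec \<Rightarrow> real) \<Rightarrow> (nat \<Rightarrow> nat \<Rightarrow> rvec \<Rightarrow> real) \<Rightarrow>
    nat \<Rightarrow> rvec \<Rightarrow> ereal" where
  "player_opt n0 Y ga gb i x = (INF z\<in>Y i. ereal (player_obj n0 ga gb i x z))"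

text \<open>On \<open>ereal\<close>, the infimum over the empty set is \<open>\<infinity>\<close>.\<close>

definition is_min_solution :: "('a \<Rightarrow> ereal) \<Rightarrow> 'a set \<Rightarrow> 'a \<Rightarrow> bool" where
  "is_min_solution f S a \<longleftrightarrow> a \<in> S \<and> f a = (INF s\<in>S. f s)"

definition is_max_solution :: "('a \<Rightarrow> ereal) \<Rightarrow> 'a set \<Rightarrow> 'a \<Rightarrow> bool" where
  "is_max_solution f S a \<longleftrightarrow> a \<in> S \<and> f a = (SUP s\<in>S. f s)"


definition P_feasible ::
  "nat \<Rightarrow> nat \<Rightarrow> (nat \<Rightarrow> rvec set) \<Rightarrow> (nat \<Rightarrow> nat \<Rightarrow> rvec \<Rightarrow> real) \<Rightarrow> (nat \<Rightarrow> rvec) set" where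
  "P_feasible m n0 Y gb =
    {y \<in> PiE {1..m} Y. \<forall>k\<in>{1..n0}. (\<Sum>i\<in>{1..m}. gb i k (y i)) = 0}"

definition P_obj :: "nat \<Rightarrow> (nat \<Rightarrow> rvec \<Rightarrow> real) \<Rightarrow> (nat \<Rightarrow> rvec) \<Rightarrow> ereal" where
  "P_obj m ga y = ereal (\<Sum>i\<in>{1..m}. ga i (y i))"

definition P_val ::
  "nat \<Rightarrow> nat \<Rightarrow> (nat \<Rightarrow> rvec set) \<Rightarrow> (nat \<Rightarrow> rvec \<Rightarrow> real) \<Rightarrow> (nat \<Rightarrow> nat \<Rightarrow> rvec \<Rightarrow> real) \<Rightarrow> ereal" where
  "P_val m n0 Y ga gb = (INF y\<in>P_feasible m n0 Y gb. P_obj m ga y)"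


definition D_obj ::
  "nat \<Rightarrow> nat \<Rightarrow> (nat \<Rightarrow> rvec set) \<Rightarrow> (nat \<Rightarrow> rvec \<Rightarrow> real) \<Rightarrow> (nat \<Rightarrow> nat \<Rightarrow> rvec \<Rightarrow> real) \<Rightarrow>
    rvec \<Rightarrow> ereal" where
  "D_obj m n0 Y ga gb x =
    (INF z\<in>PiE {1..m} Y. ereal ((\<Sum>i\<in>{1..m}. ga i (z i))
        + (\<Sum>k\<in>{1..n0}. x k * (\<Sum>i\<in>{1..m}. gb i k (z i)))))"

definition D_val ::
  "nat \<Rightarrow> nat \<Rightarrow> (nat \<Rightarrow> rvec set) \<Rightarrow> (nat \<Rightarrow> rvec \<Rightarrow> real) \<Rightarrow> (nat \<Rightarrow> nat \<Rightarrow> rvec \<Rightarrow> real) \<Rightarrow> ereal" where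
  "D_val m n0 Y ga gb = (SUP x\<in>real_space n0. D_obj m n0 Y ga gb x)"


text \<open>
  In the objective below, each \<open>player_opt\<close> value on a feasible point is less than \<open>\<infinity>\<close>, so neither
  the sum nor the difference is of the indeterminate form \<open>\<infinity> - \<infinity>\<close>.
\<close>

definition MD_feasible ::
  "nat \<Rightarrow> nat \<Rightarrow> (nat \<Rightarrow> rvec set) \<Rightarrow> (nat \<Rightarrow> nat \<Rightarrow> rvec \<Rightarrow> real) \<Rightarrow> (rvec \<times> (nat \<Rightarrow> rvec)) set" where
  "MD_feasible m n0 Y gb = real_space n0 \<times> P_feasible m n0 Y gb"

definition MD_obj ::
  "nat \<Rightarrow> nat \<Rightarrow> (nat \<Rightarrow> rvec set) \<Rightarrow> (nat \<Rightarrow> rvec \<Rightarrow> real) \<Rightarrow> (nat \<Rightarrow> nat \<Rightarrow> rvec \<Rightarrow> real) \<Rightarrow>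
    rvec \<times> (nat \<Rightarrow> rvec) \<Rightarrow> ereal" where
  "MD_obj m n0 Y ga gb = (\<lambda>(x, y).
    ereal (\<Sum>i\<in>{1..m}. ga i (y i)) - (\<Sum>i\<in>{1..m}. player_opt n0 Y ga gb i x))"

definition MD_val ::
  "nat \<Rightarrow> nat \<Rightarrow> (nat \<Rightarrow> rvec set) \<Rightarrow> (nat \<Rightarrow> rvec \<Rightarrow> real) \<Rightarrow> (nat \<Rightarrow> nat \<Rightarrow> rvec \<Rightarrow> real) \<Rightarrow> ereal" where
  "MD_val m n0 Y ga gb = (INF p\<in>MD_feasible m n0 Y gb. MD_obj m n0 Y ga gb p)"

text \<open>
  \<open>MD_obj\<close> is the total disequilibrium \<open>\<Sum>\<^sub>i (g\<^sub>i(x, y\<^sub>i) - g\<^sub>i\<^sup>*(x))\<close> restricted to the feasible set;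
  hence a minimum disequilibrium solution is the same as a solution of (MD).
\<close>

definition disequilibrium ::
  "nat \<Rightarrow> nat \<Rightarrow> (nat \<Rightarrow> rvec set) \<Rightarrow> (nat \<Rightarrow> rvec \<Rightarrow> real) \<Rightarrow> (nat \<Rightarrow> nat \<Rightarrow> rvec \<Rightarrow> real) \<Rightarrow>
    rvec \<times> (nat \<Rightarrow> rvec) \<Rightarrow> ereal" where
  "disequilibrium m n0 Y ga gb = (\<lambda>(x, y).
    \<Sum>i\<in>{1..m}. ereal (player_obj n0 ga gb i x (y i)) - player_opt n0 Y ga gb i x)"

lemma sum_ereal_diff:
  fixes a :: "'a \<Rightarrow> real" and s :: "'a \<Rightarrow> ereal"
  assumes "finite A" "\<And>i. i \<in> A \<Longrightarrow> s i < \<infinity>"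
  shows "(\<Sum>i\<in>A. ereal (a i) - s i) = ereal (\<Sum>i\<in>A. a i) - (\<Sum>i\<in>A. s i)
    \<and> (\<Sum>i\<in>A. s i) < \<infinity>"
  using assms
proof (induction A rule: finite_induct)
  case empty
  then show ?case by (simp add: zero_ereal_def)
next
  case (insert j A)
  then have IH: "(\<Sum>i\<in>A. ereal (a i) - s i) = ereal (\<Sum>i\<in>A. a i) - (\<Sum>i\<in>A. s i)"
    "(\<Sum>i\<in>A. s i) < \<infinity>" and j: "s j < \<infinity>"
    by auto
  have "(\<Sum>i\<in>insert j A. ereal (a i) - s i)
      = (ereal (a j) - s j) + (ereal (\<Sum>i\<in>A. a i) - (\<Sum>i\<in>A. s i))"
    using insert.hyps IH by simp
  moreover have "\<dots> = ereal (a j + (\<Sum>i\<in>A. a i)) - (s j + (\<Sum>i\<in>A. s i))"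
    using j IH(2) by (cases "s j"; cases "\<Sum>i\<in>A. s i") auto
  ultimately show ?case
    using insert.hyps IH(2) j by simp
qed

lemma disequilibrium_eq_MD_obj:
  assumes "p \<in> MD_feasible m n0 Y gb"
  shows "disequilibrium m n0 Y ga gb p = MD_obj m n0 Y ga gb p"
proof -
  obtain x y where p: "p = (x, y)" by (cases p)
  with assms have y: "y \<in> PiE {1..m} Y"
    and 0: "\<And>k. k \<in> {1..n0} \<Longrightarrow> (\<Sum>i\<in>{1..m}. gb i k (y i)) = 0"
    by (auto simp: MD_feasible_def P_feasible_def)
  have lt: "player_opt n0 Y ga gb i x < \<infinity>" if "i \<in> {1..m}" for i
  proof -
    have "y i \<in> Y i" using y that by (rule PiE_mem)
    then have "player_opt n0 Y ga gb i x \<le> ereal (player_obj n0 ga gb i x (y i))"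
      unfolding player_opt_def by (rule INF_lower)
    also have "\<dots> < \<infinity>" by simp
    finally show ?thesis .
  qed
  have "(\<Sum>i\<in>{1..m}. \<Sum>k\<in>{1..n0}. x k * gb i k (y i))
      = (\<Sum>k\<in>{1..n0}. x k * (\<Sum>i\<in>{1..m}. gb i k (y i)))"
    by (subst sum.swap) (simp only: sum_distrib_left)
  also have "\<dots> = 0" using 0 by simp
  finally have "(\<Sum>i\<in>{1..m}. player_obj n0 ga gb i x (y i)) = (\<Sum>i\<in>{1..m}. ga i (y i))"
    by (simp add: player_obj_def sum.distrib)
  then show ?thesis
    using sum_ereal_diff[of "{1..m}" "\<lambda>i. player_opt n0 Y ga gb i x"
        "\<lambda>i. player_obj n0 ga gb i x (y i)"] lt
    by (simp add: p disequilibrium_def MD_obj_def)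
qed

lemma minimum_disequilibrium_solution_iff:
  "is_min_solution (disequilibrium m n0 Y ga gb) (MD_feasible m n0 Y gb) p \<longleftrightarrow>
   is_min_solution (MD_obj m n0 Y ga gb) (MD_feasible m n0 Y gb) p"
  by (auto simp: is_min_solution_def disequilibrium_eq_MD_obj cong: INF_cong)

end

theory Submission
  imports Defs
begin

text \<open>
  For a fixed multiplier \<open>x\<close> the Lagrangian is a sum of terms each of which depends on the decision of
  a single player, so minimizing it over the product \<open>Y\<^sub>1 \<times> \<dots> \<times> Y\<^sub>m\<close> can be done player by player
  (\<open>INF_PiE_sum\<close>): the dual objective at \<open>x\<close> is \<open>\<Sum>\<^sub>i g\<^sub>i\<^sup>*(x)\<close> (\<open>D_obj_eq_sum_player_opt\<close>).  Hence the
  objective of (MD) is the primal objective at \<open>y\<close> minus the dual objective at \<open>x\<close>, and its feasible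
  set is the product of those of (D) and (P).  Such a separable problem is solved exactly by solving
  its two parts independently (\<open>is_min_solution_separable_diff_iff\<close>), and its value is then the
  difference of their values.

  Only infinite values need care.  The primal objective is real, and the dual objective is never
  \<open>\<infinity>\<close> because the \<open>Y\<^sub>i\<close> are nonempty, but the latter may be \<open>-\<infinity>\<close>; if it were so for every \<open>x\<close>,
  then every feasible point would be a solution of (MD), with value \<open>\<infinity>\<close>, whatever its \<open>y\<close>.  The
  point \<open>x'\<close> excludes this, so that the dual objective is finite at a solution and can be cancelled.
\<close>

text \<open>
  For finite \<open>c\<close> this is translation invariance, and for infinite \<open>c\<close> both sides equal \<open>c\<close> if \<open>I\<close> is
  nonempty.  For empty \<open>I\<close> both sides are \<open>\<infinity>\<close>, even if \<open>c = -\<infinity>\<close>, by the convention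
  \<open>\<infinity> + (-\<infinity>) = \<infinity>\<close> of \<^typ>\<open>ereal\<close>.
\<close>

lemma INF_ereal_add_const:
  fixes f :: "'a \<Rightarrow> real" and c :: ereal
  shows "(INF i\<in>I. ereal (f i) + c) = (INF i\<in>I. ereal (f i)) + c"
proof (cases c)
  case (real r)
  let ?v = "INF i\<in>I. ereal (f i) + c"
  have "?v - c \<le> (INF i\<in>I. ereal (f i))"
  proof (rule INF_greatest)
    fix i assume "i \<in> I"
    then have "?v \<le> ereal (f i) + c" by (rule INF_lower)
    then show "?v - c \<le> ereal (f i)" using real by (cases ?v) auto
  qed
  then have "?v \<le> (INF i\<in>I. ereal (f i)) + c"
    using real by (simp add: ereal_minus_le)
  moreover have "(INF i\<in>I. ereal (f i)) + c \<le> ?v"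
    by (intro INF_greatest add_right_mono INF_lower)
  ultimately show ?thesis by (rule antisym)
next
  case PInf
  then show ?thesis by (cases "I = {}") (auto simp: top_ereal_def)
next
  case MInf
  show ?thesis
  proof (cases "I = {}")
    case True
    then show ?thesis by (simp add: top_ereal_def)
  next
    case False
    then obtain i where "i \<in> I" by blast
    then have "(INF i\<in>I. ereal (f i)) \<le> ereal (f i)" by (rule INF_lower)
    then have "(INF i\<in>I. ereal (f i)) \<noteq> \<infinity>" by auto
    then show ?thesis using False MInf by simp
  qed
qed

text \<open>
  The factors are minimized one at a time: the infimum over a product of two sets is an iterated
  infimum, and at each stage the rest of the sum is a constant.
\<close>

lemma INF_PiE_sum:
  fixes h :: "'i \<Rightarrow> 'a \<Rightarrow> real"
  assumes "finite I"
  shows "(INF z\<in>PiE I A. ereal (\<Sum>i\<in>I. h i (z i))) = (\<Sum>i\<in>I. INF a\<in>A i. ereal (h i a))"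
  using assms
proof (induction I rule: finite_induct)
  case empty
  then show ?case by (simp add: zero_ereal_def)
next
  case (insert j I)
  let ?S = "\<lambda>g. ereal (\<Sum>i\<in>I. h i (g i))"
  have upd: "(\<Sum>i\<in>insert j I. h i ((g(j := a)) i)) = h j a + (\<Sum>i\<in>I. h i (g i))" for g a
  proof -
    have "(\<Sum>i\<in>I. h i ((g(j := a)) i)) = (\<Sum>i\<in>I. h i (g i))"
      using insert.hyps(2) by (intro sum.cong) auto
    then show ?thesis using insert.hyps by simp
  qed
  have "(INF z\<in>PiE (insert j I) A. ereal (\<Sum>i\<in>insert j I. h i (z i)))
      = (INF (a, g)\<in>A j \<times> PiE I A. ?S g + ereal (h j a))"
    by (simp only: PiE_insert_eq image_image case_prod_unfold upd plus_ereal.simps add.commute)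
  also have "\<dots> = (INF a\<in>A j. INF g\<in>PiE I A. ?S g + ereal (h j a))"
  proof (rule antisym)
    show "(INF (a, g)\<in>A j \<times> PiE I A. ?S g + ereal (h j a))
        \<le> (INF a\<in>A j. INF g\<in>PiE I A. ?S g + ereal (h j a))"
      by (rule INF_greatest, rule INF_greatest, rule INF_lower2, rule SigmaI) auto
  qed (auto intro!: INF_greatest intro: INF_lower2)
  also have "\<dots> = (INF a\<in>A j. ereal (h j a) + (INF g\<in>PiE I A. ?S g))"
    by (intro INF_cong refl, subst INF_ereal_add_const) (rule add.commute)
  also have "\<dots> = (INF a\<in>A j. ereal (h j a)) + (INF g\<in>PiE I A. ?S g)"
    by (rule INF_ereal_add_const)
  finally show ?case
    using insert by simp
qed

lemma D_obj_eq_sum_player_opt: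
  "D_obj m n0 Y ga gb x = (\<Sum>i\<in>{1..m}. player_opt n0 Y ga gb i x)"
proof -
  have "(\<Sum>i\<in>{1..m}. ga i (z i)) + (\<Sum>k\<in>{1..n0}. x k * (\<Sum>i\<in>{1..m}. gb i k (z i)))
      = (\<Sum>i\<in>{1..m}. player_obj n0 ga gb i x (z i))" for z
    unfolding player_obj_def sum.distrib sum_distrib_left
    by (subst sum.swap) simp
  then show ?thesis
    using INF_PiE_sum[of "{1..m}" "\<lambda>i. player_obj n0 ga gb i x" Y]
    by (simp add: D_obj_def player_opt_def)
qed

lemma is_min_solution_iff_le:
  "is_min_solution f S a \<longleftrightarrow> a \<in> S \<and> (\<forall>s\<in>S. f a \<le> f s)"
  unfolding is_min_solution_def
  by (auto intro: INF_lower intro!: antisym INF_greatest)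

lemma is_max_solution_iff_ge:
  "is_max_solution f S a \<longleftrightarrow> a \<in> S \<and> (\<forall>s\<in>S. f s \<le> f a)"
  unfolding is_max_solution_def
  by (auto intro: SUP_upper intro!: antisym SUP_least)

text \<open>
  The two coordinates are compared with the solution separately, keeping the other one fixed; the
  fixed term cancels because it is finite.  For \<open>q a\<close> this needs \<open>x'\<close>: if \<open>q a = -\<infinity>\<close>, the objective
  at \<open>(a, b)\<close> would be \<open>\<infinity>\<close> and exceed its finite value at \<open>(x', b)\<close>.
\<close>

lemma is_min_solution_separable_diff_iff:
  fixes p :: "'b \<Rightarrow> real" and q :: "'a \<Rightarrow> ereal"
  assumes lt: "\<And>x. x \<in> X \<Longrightarrow> q x < \<infinity>" and x': "x' \<in> X" "q x' > -\<infinity>"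
  shows "is_min_solution (\<lambda>(x, y). ereal (p y) - q x) (X \<times> S) (a, b) \<longleftrightarrow>
    is_min_solution (\<lambda>y. ereal (p y)) S b \<and> is_max_solution q X a"
proof
  assume "is_min_solution (\<lambda>(x, y). ereal (p y) - q x) (X \<times> S) (a, b)"
  then have ab: "a \<in> X" "b \<in> S"
    and le: "\<And>x y. x \<in> X \<Longrightarrow> y \<in> S \<Longrightarrow> ereal (p b) - q a \<le> ereal (p y) - q x"
    by (auto simp: is_min_solution_iff_le)
  have "q a \<noteq> -\<infinity>"
    using le[OF x'(1) ab(2)] x' lt[OF x'(1)] by (cases "q x'") auto
  with lt[OF ab(1)] obtain r where r: "q a = ereal r" by (cases "q a") auto
  have "p b \<le> p y" if "y \<in> S" for y
    using le[OF ab(1) that] r by simp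
  moreover have "q x \<le> q a" if "x \<in> X" for x
    using le[OF that ab(2)] r lt[OF that] by (cases "q x") auto
  ultimately show "is_min_solution (\<lambda>y. ereal (p y)) S b \<and> is_max_solution q X a"
    using ab by (auto simp: is_min_solution_iff_le is_max_solution_iff_ge)
next
  assume "is_min_solution (\<lambda>y. ereal (p y)) S b \<and> is_max_solution q X a"
  then show "is_min_solution (\<lambda>(x, y). ereal (p y) - q x) (X \<times> S) (a, b)"
    unfolding is_min_solution_iff_le is_max_solution_iff_ge
    by (auto intro!: ereal_minus_mono)
qed

theorem theorem2:
  fixes m n0 :: nat and n :: "nat \<Rightarrow> nat"
    and Y :: "nat \<Rightarrow> rvec set"
    and ga :: "nat \<Rightarrow> rvec \<Rightarrow> real"
    and gb :: "nat \<Rightarrow> nat \<Rightarrow> rvec \<Rightarrow> real"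
    and xs :: rvec and ys :: "nat \<Rightarrow> rvec"
  assumes "\<forall>i\<in>{1..m}. Y i \<subseteq> real_space (n i) \<and> Y i \<noteq> {}"
    and "\<exists>x'\<in>real_space n0. \<forall>i\<in>{1..m}. player_opt n0 Y ga gb i x' > -\<infinity>"
  shows "(is_min_solution (MD_obj m n0 Y ga gb) (MD_feasible m n0 Y gb) (xs, ys) \<longrightarrow>
            MD_val m n0 Y ga gb = P_val m n0 Y ga gb - D_val m n0 Y ga gb)
       \<and> (is_min_solution (MD_obj m n0 Y ga gb) (MD_feasible m n0 Y gb) (xs, ys) \<longleftrightarrow>
            is_min_solution (P_obj m ga) (P_feasible m n0 Y gb) ys
          \<and> is_max_solution (D_obj m n0 Y ga gb) (real_space n0) xs)"
proof -
  let ?MD = "is_min_solution (MD_obj m n0 Y ga gb) (MD_feasible m n0 Y gb) (xs, ys)"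
  have MD_obj: "MD_obj m n0 Y ga gb
      = (\<lambda>(x, y). ereal (\<Sum>i\<in>{1..m}. ga i (y i)) - D_obj m n0 Y ga gb x)"
    by (simp add: MD_obj_def D_obj_eq_sum_player_opt)
  have D_lt: "D_obj m n0 Y ga gb x < \<infinity>" for x
  proof -
    obtain z where "z \<in> PiE {1..m} Y"
      using assms(1) by (metis PiE_eq_empty_iff ex_in_conv)
    then show ?thesis
      unfolding D_obj_def by (rule INF_lower[THEN le_less_trans]) simp
  qed
  obtain x' where x': "x' \<in> real_space n0" "\<forall>i\<in>{1..m}. player_opt n0 Y ga gb i x' > -\<infinity>"
    using assms(2) by blast
  have "(\<Sum>i\<in>J. player_opt n0 Y ga gb i x') > -\<infinity>" if "finite J" "J \<subseteq> {1..m}" for J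
    using that x'(2) by (induction J rule: finite_induct) auto
  then have D_gt: "D_obj m n0 Y ga gb x' > -\<infinity>"
    by (simp add: D_obj_eq_sum_player_opt)
  have iff: "?MD \<longleftrightarrow> is_min_solution (P_obj m ga) (P_feasible m n0 Y gb) ys
      \<and> is_max_solution (D_obj m n0 Y ga gb) (real_space n0) xs"
    unfolding MD_obj MD_feasible_def P_obj_def
    using D_lt x'(1) D_gt
    by (intro is_min_solution_separable_diff_iff[where q = "D_obj m n0 Y ga gb"
          and p = "\<lambda>y. \<Sum>i\<in>{1..m}. ga i (y i)" and x' = x'])
  moreover have "MD_val m n0 Y ga gb = P_val m n0 Y ga gb - D_val m n0 Y ga gb" if ?MD
  proof -
    have "MD_val m n0 Y ga gb = MD_obj m n0 Y ga gb (xs, ys)"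
      using that by (simp add: is_min_solution_def MD_val_def)
    also have "\<dots> = P_obj m ga ys - D_obj m n0 Y ga gb xs"
      by (simp add: MD_obj P_obj_def)
    also have "\<dots> = P_val m n0 Y ga gb - D_val m n0 Y ga gb"
      using that iff by (simp add: is_min_solution_def is_max_solution_def P_val_def D_val_def)
    finally show ?thesis .
  qed
  ultimately show ?thesis by blast
qed

end
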